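(* Let $\xi \in \mathbb{R} \setminus \mathbb{Q}$, let $\mu$ be a real number with $\mu > \mu(\xi)$, and let $(Q_n)$ and $(\varepsilon_n)$ be sequences of positive real numbers such that $\lim_{n\to+\infty} Q_n = +\infty$, $\lim_{n\to+\infty}\varepsilon_n = 0$, and $\varepsilon_n \geq Q_n^{-\frac{1}{\mu-1} + \delta_n}$ for some sequence of real numbers $(\delta_n)$ tending to $0$. Then there exist integer sequences $(u_n)$ and $(v_n)$ such that $$\lim_{n\to +\infty} \frac{u_n}{Q_n} = \lim_{n\to +\infty} \frac{u_n\xi - v_n}{\varepsilon_n} = 1.$$
   Context: For an irrational real number $\xi$, the irrationality exponent $\mu(\xi)$ is the infimum of all real numbers $\mu$ such that the inequality $|\xi - p/q| > q^{-\mu}$ holds for all integers $p, q$ with $q$ sufficiently large (it may be $+\infty$). *)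

theory Defs
  imports "HOL-Analysis.Analysis"
begin

(* Extended-real valued: the infimum of the empty set is infinity, which covers Liouville numbers. *)
definition irrationality_exponent :: "real \<Rightarrow> ereal" where
  "irrationality_exponent \<xi> =
     Inf (ereal ` {\<mu>. \<forall>\<^sub>F q :: int in at_top. \<forall>p :: int.
       \<bar>\<xi> - of_int p / of_int q\<bar> > of_int q powr (- \<mu>)})"

end

theory Submission
  imports Defs
begin

text \<open>
  The integer points \<open>(u, u \<xi> - v)\<close> form a lattice of covolume 1. Dirichlet's theorem gives a coprime
  pair \<open>(q, p)\<close> with \<open>q \<le> N\<close> and \<open>\<bar>q \<xi> - p\<bar> < 1 / N\<close>; completed by Bezout to a lattice basis, it shows
  that every point of the plane is within \<open>2 q\<close> and \<open>3 / q\<close> (in the two coordinates) of the lattice.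
  An exponent \<open>\<nu> < \<mu>\<close> admissible for \<open>\<xi>\<close> forces \<open>q\<close> to be at least of order \<open>N powr (1 / (\<nu> - 1))\<close>. With \<open>N\<close>
  slightly smaller than \<open>Q n\<close>, both errors are negligible compared with \<open>Q n\<close> and \<open>\<epsilon> n\<close>.
\<close>

text \<open>Adding a multiple of \<open>(q, p)\<close> to a second vector preserves the determinant,
  so a Bezout coefficient can be reduced modulo \<open>q\<close>. The range of \<open>q'\<close>
  keeps the second basis vector short.\<close>

lemma coprime_basis_completion:
  fixes p q :: int
  assumes "coprime p q" "q > 0"
  obtains p' q' where "q * p' - p * q' = 1" "0 \<le> q'" "q' < q"
proof -
  obtain a b where ab: "a * p + b * q = 1"
    using assms(1) by (metis bezout_int coprime_iff_gcd_eq_1)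
  define k where "k = (- a) div q"
  define r where "r = (- a) mod q"
  have r: "a = - (k * q + r)" unfolding k_def r_def by simp
  show thesis
  proof (rule that[of "b - k * p" r])
    show "q * (b - k * p) - p * r = 1"
      using ab r by (simp add: algebra_simps)
    show "0 \<le> r" "r < q" using assms(2) by (auto simp: r_def)
  qed
qed

text \<open>Expand the target \<open>(U, E)\<close> in the lattice basis \<open>(q, e)\<close>,
  \<open>(q', e')\<close> and round both coordinates down. The error is a combination of the basis
  vectors with coefficients in \<open>[0, 1)\<close>, so it is at most \<open>q + q'\<close> in the
  first coordinate and \<open>1 / q + 2 / q\<close> in the second.\<close>

lemma lattice_point_near:
  fixes \<xi> U E :: real and p q :: int
  assumes cop: "coprime p q" and q: "q > 0" and close: "\<bar>of_int q * \<xi> - of_int p\<bar> \<le> 1 / of_int q"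
  shows "\<exists>u v :: int. \<bar>of_int u - U\<bar> \<le> 2 * of_int q \<and> \<bar>of_int u * \<xi> - of_int v - E\<bar> \<le> 3 / of_int q"
proof -
  obtain p' q' where det: "q * p' - p * q' = 1" and q': "0 \<le> q'" "q' < q"
    using coprime_basis_completion[OF cop q] .
  define e where "e = of_int q * \<xi> - of_int p"
  define e' where "e' = of_int q' * \<xi> - of_int p'"
  have det_real: "of_int q * of_int p' - of_int p * of_int q' = (1::real)"
    using det by (metis of_int_1 of_int_diff of_int_mult)
  then have det_e: "of_int q' * e - of_int q * e' = 1"
    by (simp add: e_def e'_def algebra_simps)
  have e: "\<bar>e\<bar> \<le> 1 / of_int q" using close by (simp add: e_def)
  \<comment> \<open>The determinant relation transfers the smallness of \<open>e\<close> to
    \<open>e'\<close>, at the price of a factor 2.\<close>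
  have "\<bar>of_int q * e'\<bar> = \<bar>of_int q' * e - 1\<bar>" using det_e by (simp add: algebra_simps)
  also have "\<dots> \<le> \<bar>of_int q' * e\<bar> + 1" by linarith
  also have "\<bar>of_int q' * e\<bar> \<le> of_int q * (1 / of_int q)"
    unfolding abs_mult using q' q e by (intro mult_mono) auto
  finally have "\<bar>of_int q * e'\<bar> \<le> 2" using q by simp
  then have e': "\<bar>e'\<bar> \<le> 2 / of_int q"
    using q by (simp add: abs_mult field_simps)
  \<comment> \<open>Cramer's rule for the coordinates of \<open>(U, E)\<close>; the determinant is a
    unit, so no division occurs.\<close>
  define s where "s = E * of_int q' - U * e'"
  define t where "t = U * e - E * of_int q"
  have "s * of_int q + t * of_int q' = U * (of_int q' * e - of_int q * e')"
    "s * e + t * e' = E * (of_int q' * e - of_int q * e')"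
    by (simp_all add: s_def t_def algebra_simps)
  then have U: "s * of_int q + t * of_int q' = U" and E: "s * e + t * e' = E"
    using det_e by simp_all
  define u where "u = \<lfloor>s\<rfloor> * q + \<lfloor>t\<rfloor> * q'"
  define v where "v = \<lfloor>s\<rfloor> * p + \<lfloor>t\<rfloor> * p'"
  have fracs: "\<bar>frac s\<bar> \<le> 1" "\<bar>frac t\<bar> \<le> 1"
    using frac_lt_1[of s] frac_lt_1[of t] by auto
  have weighted: "\<bar>frac s * x + frac t * y\<bar> \<le> \<bar>x\<bar> + \<bar>y\<bar>" for x y
  proof -
    have "\<bar>frac s * x + frac t * y\<bar> \<le> \<bar>frac s\<bar> * \<bar>x\<bar> + \<bar>frac t\<bar> * \<bar>y\<bar>"
      by (metis abs_mult abs_triangle_ineq)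
    also have "\<dots> \<le> \<bar>x\<bar> + \<bar>y\<bar>"
      using fracs by (intro add_mono mult_left_le_one_le) auto
    finally show ?thesis .
  qed
  have "of_int u - U = - (frac s * of_int q + frac t * of_int q')"
    by (simp add: u_def frac_def algebra_simps flip: U)
  then have "\<bar>of_int u - U\<bar> \<le> 2 * of_int q"
    using weighted[of "of_int q" "of_int q'"] q' by linarith
  moreover have "of_int u * \<xi> - of_int v - E = - (frac s * e + frac t * e')"
    by (simp add: u_def v_def frac_def algebra_simps e_def e'_def flip: E)
  then have "\<bar>of_int u * \<xi> - of_int v - E\<bar> \<le> 3 / of_int q"
    using weighted[of e e'] e e' by (simp only: abs_minus_cancel)
  ultimately show ?thesis by blast
qed

text \<open>The denominators coming from Dirichlet's theorem are not known in advance to be large,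
  so the asymptotic bound is traded for one valid at every positive denominator, with a constant
  factor lost.\<close>

lemma uniform_irrationality_bound:
  fixes \<xi> \<nu> :: real
  assumes "\<forall>\<^sub>F q :: int in at_top. \<forall>p :: int. \<bar>\<xi> - of_int p / of_int q\<bar> > of_int q powr (- \<nu>)"
  obtains c where "c > 0" "\<And>p q :: int. q > 0 \<Longrightarrow> \<bar>\<xi> - of_int p / of_int q\<bar> > c * of_int q powr (- \<nu>)"
proof -
  obtain K0 :: int where K0: "\<And>p q :: int. q \<ge> K0 \<Longrightarrow> \<bar>\<xi> - of_int p / of_int q\<bar> > of_int q powr (- \<nu>)"
    using assms unfolding eventually_at_top_linorder by blast
  define K where "K = max 1 K0"
  have "\<bar>\<xi> - of_int p / of_int q\<bar> > of_int K powr (- \<nu>) * of_int q powr (- \<nu>)" if "q > 0" for p q :: int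
  proof -
    \<comment> \<open>Expanding the fraction by \<open>K\<close> makes the denominator large enough for \<open>K0\<close>.\<close>
    have "K * 1 \<le> K * q" using that by (intro mult_left_mono) (auto simp: K_def)
    then have "K0 \<le> K * q" by (simp add: K_def)
    moreover have "K > 0" by (simp add: K_def)
    ultimately show ?thesis
      using K0[of "K * q" "K * p"] that by (simp add: powr_mult)
  qed
  then show thesis by (intro that[of "of_int K powr (- \<nu>)"]) (auto simp: K_def)
qed

text \<open>Multiplying the lower bound for \<open>\<bar>\<xi> - p / q\<bar>\<close> by
  \<open>q\<close> and comparing with the Dirichlet upper bound shows that good approximations need
  large denominators.\<close>

lemma Dirichlet_denominator_bound:
  fixes \<xi> \<nu> c :: real and p q :: int
  assumes c: "\<And>p q :: int. q > 0 \<Longrightarrow> \<bar>\<xi> - of_int p / of_int q\<bar> > c * of_int q powr (- \<nu>)"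
    and "q > 0" "N > 0" "\<bar>of_int q * \<xi> - of_int p\<bar> < 1 / real N"
  shows "c * real N < of_int q powr (\<nu> - 1)"
proof -
  have "\<bar>\<xi> - of_int p / of_int q\<bar> = \<bar>of_int q * \<xi> - of_int p\<bar> / of_int q"
    using assms(2) by (simp add: field_simps abs_if)
  then have "c * of_int q powr (- \<nu>) * of_int q < 1 / real N"
    using c[OF assms(2), of p] assms(2,4) by (simp add: field_simps)
  also have "c * of_int q powr (- \<nu>) * of_int q = c / of_int q powr (\<nu> - 1)"
    using assms(2) by (simp add: powr_diff powr_minus field_simps)
  finally show ?thesis using assms(2,3) by (simp add: field_simps)
qed

text \<open>For \<open>\<nu> \<le> 1\<close> the power \<open>q powr (\<nu> - 1)\<close> never
  exceeds 1, whereas a Dirichlet denominator for \<open>N \<ge> 1 / c\<close> would make it exceed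
  \<open>c * N \<ge> 1\<close>.\<close>

lemma admissible_exponent_gt_1:
  fixes \<xi> \<nu> c :: real
  assumes "c > 0" and c: "\<And>p q :: int. q > 0 \<Longrightarrow> \<bar>\<xi> - of_int p / of_int q\<bar> > c * of_int q powr (- \<nu>)"
  shows "\<nu> > 1"
proof (rule ccontr)
  assume "\<not> \<nu> > 1"
  define N where "N = nat \<lceil>1 / c\<rceil>"
  have N: "N > 0" "1 / c \<le> real N"
    using assms(1) by (auto simp: N_def real_nat_ceiling_ge)
  then have cN: "1 \<le> c * real N" using assms(1) by (simp add: field_simps)
  obtain p q :: int where pq: "0 < q" "\<bar>of_int q * \<xi> - of_int p\<bar> < 1 / real N"
    using Dirichlet_approx_coprime[OF N(1), of \<xi>] by metis
  have "of_int q powr (\<nu> - 1) \<le> of_int q powr (0::real)"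
    using pq(1) \<open>\<not> \<nu> > 1\<close> by (intro powr_mono) auto
  then show False
    using Dirichlet_denominator_bound[OF c pq(1) N(1) pq(2)] cN pq(1) by simp
qed

text \<open>Dirichlet's theorem at level \<open>N = \<lceil>X\<rceil>\<close> yields a denominator
  \<open>q\<close> bounded above by \<open>X + 1\<close> and below by a power of
  \<open>c * X\<close>; these control the two errors \<open>2 * q\<close> and
  \<open>3 / q\<close>.\<close>

lemma simultaneous_approximation:
  fixes \<xi> \<nu> c X U E :: real
  assumes "c > 0" and c: "\<And>p q :: int. q > 0 \<Longrightarrow> \<bar>\<xi> - of_int p / of_int q\<bar> > c * of_int q powr (- \<nu>)"
    and "X > 0"
  shows "\<exists>u v :: int. \<bar>of_int u - U\<bar> \<le> 2 * (X + 1) \<and>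
           \<bar>of_int u * \<xi> - of_int v - E\<bar> \<le> 3 * (c * X) powr (- (1 / (\<nu> - 1)))"
proof -
  define N where "N = nat \<lceil>X\<rceil>"
  have N: "N > 0" "X \<le> real N" "real N \<le> X + 1"
    using assms(3) by (auto simp: N_def real_nat_ceiling_ge)
  obtain p q where pq: "coprime p q" "0 < q" "q \<le> int N" "\<bar>of_int q * \<xi> - of_int p\<bar> < 1 / real N"
    using Dirichlet_approx_coprime[OF N(1), of \<xi>] by metis
  have qN: "of_int q \<le> real N" using pq(3) by linarith
  then have "1 / real N \<le> 1 / of_int q" using pq(2) N(1) by (simp add: field_simps)
  then obtain u v where uv: "\<bar>of_int u - U\<bar> \<le> 2 * of_int q" "\<bar>of_int u * \<xi> - of_int v - E\<bar> \<le> 3 / of_int q"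
    using lattice_point_near[OF pq(1,2), of \<xi> U E] pq(4) by force
  have \<nu>: "\<nu> > 1" by (rule admissible_exponent_gt_1[OF assms(1) c])
  have "c * X \<le> c * real N" using N(2) assms(1) by simp
  also have "\<dots> < of_int q powr (\<nu> - 1)"
    by (rule Dirichlet_denominator_bound[OF c pq(2) N(1) pq(4)])
  \<comment> \<open>The exponent is negative because \<open>\<nu> > 1\<close>, so the lower bound on
    \<open>q\<close> turns into an upper bound on \<open>1 / q\<close>.\<close>
  finally have "(of_int q powr (\<nu> - 1)) powr (- (1 / (\<nu> - 1))) \<le> (c * X) powr (- (1 / (\<nu> - 1)))"
    using assms(1,3) \<nu> by (intro powr_mono2') auto
  moreover have "(of_int q powr (\<nu> - 1)) powr (- (1 / (\<nu> - 1))) = 1 / of_int q"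
    using \<nu> pq(2) by (simp add: powr_powr powr_minus field_simps)
  ultimately have "3 / of_int q \<le> 3 * (c * X) powr (- (1 / (\<nu> - 1)))" by simp
  moreover have "2 * of_int q \<le> 2 * (X + 1)" using order_trans[OF qN N(3)] by simp
  ultimately show ?thesis using uv by (meson order_trans)
qed

lemma tendsto_ratio_1I:
  fixes f g b :: "nat \<Rightarrow> real"
  assumes "\<And>n. g n > 0" "\<And>n. \<bar>f n - g n\<bar> \<le> b n" "(\<lambda>n. b n / g n) \<longlonglongrightarrow> 0"
  shows "(\<lambda>n. f n / g n) \<longlonglongrightarrow> 1"
proof -
  have "norm (f n / g n - 1) \<le> b n / g n" for n
  proof -
    have "f n / g n - 1 = (f n - g n) / g n" using assms(1)[of n] by (simp add: field_simps)
    then show ?thesis using assms(1,2)[of n] by (simp add: divide_right_mono)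
  qed
  then have "(\<lambda>n. f n / g n - 1) \<longlonglongrightarrow> 0"
    by (intro Lim_null_comparison[OF always_eventually assms(3)]) auto
  then show ?thesis by (rule LIM_zero_cancel)
qed

text \<open>Once \<open>Q n \<ge> 1\<close> and \<open>a n < l / 2\<close>, the varying power is
  dominated by the fixed negative power \<open>l / 2\<close>.\<close>

lemma tendsto_powr_vanishing:
  fixes Q a :: "nat \<Rightarrow> real"
  assumes Q: "filterlim Q at_top sequentially" and a: "a \<longlonglongrightarrow> l" and "l < 0"
  shows "(\<lambda>n. Q n powr a n) \<longlonglongrightarrow> 0"
proof (rule tendsto_sandwich[OF _ _ tendsto_const])
  show "(\<lambda>n. Q n powr (l / 2)) \<longlonglongrightarrow> 0"
    using assms(3) by (intro tendsto_neg_powr Q) simp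
  have "\<forall>\<^sub>F n in sequentially. a n < l / 2"
    using assms(3) by (intro order_tendstoD(2)[OF a]) simp
  moreover have "\<forall>\<^sub>F n in sequentially. Q n \<ge> 1"
    using Q by (simp add: filterlim_at_top)
  ultimately show "\<forall>\<^sub>F n in sequentially. Q n powr a n \<le> Q n powr (l / 2)"
    by eventually_elim (intro powr_mono, auto)
qed auto

theorem theorem2:
  fixes \<xi> \<mu> :: real and Q \<epsilon> \<delta> :: "nat \<Rightarrow> real"
  assumes "\<xi> \<notin> \<rat>"
    and "ereal \<mu> > irrationality_exponent \<xi>"
    and "\<And>n. Q n > 0"
    and "\<And>n. \<epsilon> n > 0"
    and "filterlim Q at_top sequentially"
    and "\<epsilon> \<longlonglongrightarrow> 0"
    and "\<delta> \<longlonglongrightarrow> 0"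
    and "\<And>n. \<epsilon> n \<ge> Q n powr (- (1 / (\<mu> - 1)) + \<delta> n)"
  shows "\<exists>u v :: nat \<Rightarrow> int.
           (\<lambda>n. of_int (u n) / Q n) \<longlonglongrightarrow> 1 \<and>
           (\<lambda>n. (of_int (u n) * \<xi> - of_int (v n)) / \<epsilon> n) \<longlonglongrightarrow> 1"
proof -
  \<comment> \<open>Since \<open>\<mu>\<close> lies strictly above the infimum, some admissible
    \<open>\<nu>\<close> lies strictly below \<open>\<mu>\<close>; this gap later absorbs
    \<open>\<delta>\<close>.\<close>
  obtain \<nu> where \<nu>_less: "\<nu> < \<mu>"
    and ev: "\<forall>\<^sub>F q :: int in at_top. \<forall>p :: int. \<bar>\<xi> - of_int p / of_int q\<bar> > of_int q powr (- \<nu>)"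
    using assms(2) unfolding irrationality_exponent_def Inf_less_iff by auto
  obtain c where "c > 0"
    and c: "\<And>p q :: int. q > 0 \<Longrightarrow> \<bar>\<xi> - of_int p / of_int q\<bar> > c * of_int q powr (- \<nu>)"
    using uniform_irrationality_bound[OF ev] by blast
  have \<nu>: "\<nu> > 1" by (rule admissible_exponent_gt_1[OF \<open>c > 0\<close> c])
  \<comment> \<open>Half of the gap between the two decay exponents is spent on making
    \<open>X n\<close> negligible against \<open>Q n\<close>: \<open>\<eta>\<close> is chosen so
    that \<open>X n powr (- (1 / (\<nu> - 1)))\<close> decays with the midpoint exponent
    \<open>1 / (\<mu> - 1) + \<kappa>\<close>. The other half makes this error negligible against
    \<open>\<epsilon> n\<close>.\<close>
  define \<kappa> where "\<kappa> = (1 / (\<nu> - 1) - 1 / (\<mu> - 1)) / 2"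
  define \<eta> where "\<eta> = \<kappa> * (\<nu> - 1)"
  have "\<kappa> > 0" using \<nu> \<nu>_less by (simp add: \<kappa>_def frac_less2)
  then have "\<eta> > 0" using \<nu> by (simp add: \<eta>_def)
  define X where "X = (\<lambda>n. Q n powr (1 - \<eta>))"
  define C where "C = 3 * c powr (- (1 / (\<nu> - 1)))"
  have X: "X n > 0" for n using assms(3)[of n] by (simp add: X_def)
  have "\<exists>u v :: int. \<bar>of_int u - Q n\<bar> \<le> 2 * (X n + 1) \<and>
      \<bar>of_int u * \<xi> - of_int v - \<epsilon> n\<bar> \<le> 3 * (c * X n) powr (- (1 / (\<nu> - 1)))" for n
    by (rule simultaneous_approximation[OF \<open>c > 0\<close> c X])
  then obtain u v :: "nat \<Rightarrow> int" where u: "\<And>n. \<bar>of_int (u n) - Q n\<bar> \<le> 2 * (X n + 1)"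
    and v: "\<And>n. \<bar>of_int (u n) * \<xi> - of_int (v n) - \<epsilon> n\<bar> \<le> 3 * (c * X n) powr (- (1 / (\<nu> - 1)))"
    by metis
  have "(\<lambda>n. 2 * (Q n powr (- \<eta>) + 1 / Q n)) \<longlonglongrightarrow> 2 * (0 + 0)"
    using \<open>\<eta> > 0\<close> assms(5)
    by (intro tendsto_intros tendsto_neg_powr tendsto_divide_0[OF tendsto_const] filterlim_at_top_imp_at_infinity) auto
  moreover have "2 * (Q n powr (- \<eta>) + 1 / Q n) = 2 * (X n + 1) / Q n" for n
    using assms(3)[of n] by (simp add: X_def powr_diff powr_minus field_simps)
  ultimately have "(\<lambda>n. 2 * (X n + 1) / Q n) \<longlonglongrightarrow> 0" by simp
  with assms(3) u have lim_u: "(\<lambda>n. of_int (u n) / Q n) \<longlonglongrightarrow> 1"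
    by (rule tendsto_ratio_1I)
  have "(1 - \<eta>) / (\<nu> - 1) = 1 / (\<nu> - 1) - \<kappa>"
    using \<nu> by (simp add: \<eta>_def field_simps)
  also have "\<dots> = 1 / (\<mu> - 1) + \<kappa>" by (simp add: \<kappa>_def field_simps)
  finally have expo: "(1 - \<eta>) / (\<nu> - 1) = 1 / (\<mu> - 1) + \<kappa>" .
  have bound: "3 * (c * X n) powr (- (1 / (\<nu> - 1))) / \<epsilon> n \<le> C * Q n powr (- \<kappa> - \<delta> n)" for n
  proof -
    have "X n powr (- (1 / (\<nu> - 1))) = Q n powr (- ((1 - \<eta>) / (\<nu> - 1)))"
      by (simp add: X_def powr_powr)
    then have numerator: "3 * (c * X n) powr (- (1 / (\<nu> - 1))) = C * Q n powr (- (1 / (\<mu> - 1)) - \<kappa>)"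
      using \<open>c > 0\<close> X[of n] unfolding expo by (simp add: C_def powr_mult)
    \<comment> \<open>Dividing by the lower bound for \<open>\<epsilon> n\<close> cancels the
      exponent \<open>1 / (\<mu> - 1)\<close> and leaves \<open>- \<kappa> - \<delta> n\<close>,
      which tends to the negative number \<open>- \<kappa>\<close>.\<close>
    have "C * Q n powr (- (1 / (\<mu> - 1)) - \<kappa>) / \<epsilon> n
        \<le> C * Q n powr (- (1 / (\<mu> - 1)) - \<kappa>) / Q n powr (- (1 / (\<mu> - 1)) + \<delta> n)"
      using assms(8)[of n] assms(3)[of n] assms(4)[of n] by (intro divide_left_mono) (auto simp: C_def)
    also have "\<dots> = C * Q n powr (- \<kappa> - \<delta> n)"
      by (simp flip: powr_diff times_divide_eq_right)
    finally show ?thesis unfolding numerator .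
  qed
  have "(\<lambda>n. - \<kappa> - \<delta> n) \<longlonglongrightarrow> - \<kappa> - 0" by (intro tendsto_intros assms(7))
  then have lim_bound: "(\<lambda>n. C * Q n powr (- \<kappa> - \<delta> n)) \<longlonglongrightarrow> 0"
    using \<open>\<kappa> > 0\<close> by (intro tendsto_mult_right_zero tendsto_powr_vanishing[OF assms(5)]) auto
  have "0 \<le> 3 * (c * X n) powr (- (1 / (\<nu> - 1))) / \<epsilon> n" for n
    using assms(4)[of n] by simp
  then have "(\<lambda>n. 3 * (c * X n) powr (- (1 / (\<nu> - 1))) / \<epsilon> n) \<longlonglongrightarrow> 0"
    using bound by (intro tendsto_sandwich[OF _ _ tendsto_const lim_bound] always_eventually) auto
  with assms(4) v have "(\<lambda>n. (of_int (u n) * \<xi> - of_int (v n)) / \<epsilon> n) \<longlonglongrightarrow> 1"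
    by (rule tendsto_ratio_1I)
  with lim_u show ?thesis by blast
qed

end
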